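(* Let $0<T<\infty$, $a,b\in\mathbb{R}$, and let $(B_t)_{t\in[0,T]}$ be the continuous version of $B_t=\langle\cdot,\mathbf{1}_{[0,t)}\rangle$ on the white noise space, and $$X_t:=a\Big(1-\frac tT\Big)+b\frac tT+B_t-\frac tT B_T,\qquad 0\le t\le T,$$ the one-dimensional Brownian bridge from $a$ to $b$. For $\varepsilon>0$ let $$\mathcal{I}^{BB}_\varepsilon:=\int_0^T\int_0^t p_\varepsilon(X_t-X_s)\,ds\,dt,\qquad p_\varepsilon(x)=\frac{1}{\sqrt{2\pi\varepsilon}}e^{-x^2/(2\varepsilon)}.$$ Then $\mathcal{I}^{BB}_\varepsilon$ converges in $L^2(\mu)$ as $\varepsilon\downarrow 0$; the limit is denoted $\mathcal{I}^{BB}\in L^2(\mu)$.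
   Context: $\mu$ is the white noise measure on the space $\mathcal{S}'(\mathbb{R})$ of tempered distributions, i.e. $\int\exp(i\langle\omega,\xi\rangle)d\mu(\omega)=\exp(-\frac12\langle\xi,\xi\rangle)$ for Schwartz functions $\xi$, where $\langle\cdot,\cdot\rangle$ is the dual pairing extending the $L^2(\mathbb{R})$ inner product; for $\xi\in L^2(\mathbb{R})$, $\langle\cdot,\xi\rangle$ is defined as an $L^2(\mu)$-limit. Then $(B_t)$ is a standard one-dimensional Brownian motion starting at $0$ (continuous modification taken). $L^2(\mu)$ is the space of complex-valued square-integrable functions w.r.t. $\mu$. *)

theory Defs
  imports "HOL-Probability.Probability"
begin

definition std_brownian_motion :: "'a measure \<Rightarrow> (real \<Rightarrow> 'a \<Rightarrow> real) \<Rightarrow> bool" where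
  "std_brownian_motion M B \<longleftrightarrow>
     prob_space M \<and>
     (\<forall>t. B t \<in> borel_measurable M) \<and>
     (\<forall>\<omega>\<in>space M. B 0 \<omega> = 0 \<and> continuous_on {0..} (\<lambda>t. B t \<omega>)) \<and>
     (\<forall>s t. 0 \<le> s \<longrightarrow> s < t \<longrightarrow>
        distributed M lborel (\<lambda>\<omega>. B t \<omega> - B s \<omega>) (normal_density 0 (sqrt (t - s)))) \<and>
     (\<forall>(n::nat) (ts::nat \<Rightarrow> real). 0 \<le> ts 0 \<longrightarrow> (\<forall>i<n. ts i < ts (Suc i)) \<longrightarrow>
        prob_space.indep_vars M (\<lambda>_. borel) (\<lambda>i \<omega>. B (ts (Suc i)) \<omega> - B (ts i) \<omega>) {..<n})"

definition heat_kernel :: "real \<Rightarrow> real \<Rightarrow> real" where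
  "heat_kernel \<epsilon> x = exp (- x\<^sup>2 / (2 * \<epsilon>)) / sqrt (2 * pi * \<epsilon>)"

definition brownian_bridge :: "real \<Rightarrow> real \<Rightarrow> real \<Rightarrow> (real \<Rightarrow> 'a \<Rightarrow> real) \<Rightarrow> real \<Rightarrow> 'a \<Rightarrow> real" where
  "brownian_bridge T a b B t \<omega> = a * (1 - t / T) + b * (t / T) + B t \<omega> - (t / T) * B T \<omega>"

definition approx_SILT :: "real \<Rightarrow> real \<Rightarrow> real \<Rightarrow> (real \<Rightarrow> 'a \<Rightarrow> real) \<Rightarrow> real \<Rightarrow> 'a \<Rightarrow> real" where
  "approx_SILT T a b B \<epsilon> \<omega> =
     (LBINT t:{0..T}. LBINT s:{0..t}.
        heat_kernel \<epsilon> (brownian_bridge T a b B t \<omega> - brownian_bridge T a b B s \<omega>))"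

end

theory Submission
  imports Defs
begin

text \<open>
  Both existence of the limit and convergence follow from monotonicity in \<open>\<epsilon>\<close>. The
  Fourier representation of the heat kernel gives, path by path,
  \<open>2 I\<^sub>\<epsilon> = 1/(2\<pi>) \<integral> exp(- \<epsilon> v\<^sup>2 / 2) |\<integral>\<^sub>0\<^sup>T exp(i v X\<^sub>t) dt|\<^sup>2 dv\<close>, which increases as
  \<open>\<epsilon>\<close> decreases to 0. Hence a bound on the second moments of \<open>I\<^sub>\<epsilon>\<close> that is uniform in \<open>\<epsilon>\<close>
  suffices, by monotone and dominated convergence. By Cauchy-Schwarz the second moment is at most
  \<open>2T\<close> times the integral over \<open>r < s < t\<close> of the expectation of
  \<open>p\<^sub>\<epsilon>(X\<^sub>t - X\<^sub>r) p\<^sub>\<epsilon>(X\<^sub>t - X\<^sub>s)\<close>. Bounding the densities of the two independent increments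
  \<open>B\<^sub>s - B\<^sub>r\<close> and \<open>B\<^sub>t - B\<^sub>s\<close> by their maxima, this expectation is at most
  \<open>T / (2 \<pi> (T - (t - r)) sqrt ((s - r) (t - s)))\<close>, and by AM-GM, applied to
  \<open>T - (t - r) = r + (T - t)\<close>, the integral splits for fixed \<open>s\<close> into two arcsine integrals.
\<close>

section \<open>The heat kernel and its Fourier representation\<close>

lemma heat_kernel_eq_normal_density:
  "0 < \<epsilon> \<Longrightarrow> heat_kernel \<epsilon> x = normal_density 0 (sqrt \<epsilon>) x"
  by (simp add: heat_kernel_def normal_density_def)

lemma heat_kernel_nonneg [simp]: "0 < \<epsilon> \<Longrightarrow> 0 \<le> heat_kernel \<epsilon> x"
  by (simp add: heat_kernel_eq_normal_density)

lemma heat_kernel_minus: "heat_kernel \<epsilon> (x - y) = heat_kernel \<epsilon> (y - x)"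
  by (simp add: heat_kernel_def power2_commute)

lemma borel_measurable_heat_kernel [measurable]: "heat_kernel \<epsilon> \<in> borel_measurable borel"
  unfolding heat_kernel_def by measurable

lemma heat_kernel_le: "0 < \<epsilon> \<Longrightarrow> heat_kernel \<epsilon> x \<le> 1 / sqrt (2 * pi * \<epsilon>)"
  by (simp add: heat_kernel_def divide_simps)

lemma nn_integral_heat_kernel_affine:
  assumes "0 < \<epsilon>" "c \<noteq> 0"
  shows "(\<integral>\<^sup>+x. heat_kernel \<epsilon> (k + c * x) \<partial>lborel) = ennreal (1 / \<bar>c\<bar>)"
proof -
  have "(\<integral>\<^sup>+x. heat_kernel \<epsilon> x \<partial>lborel) = 1"
    using assms by (simp add: heat_kernel_eq_normal_density nn_integral_eq_integral)
  also have "(\<integral>\<^sup>+x. heat_kernel \<epsilon> x \<partial>lborel) = \<bar>c\<bar> * (\<integral>\<^sup>+x. heat_kernel \<epsilon> (k + c * x) \<partial>lborel)"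
    by (rule nn_integral_real_affine) (use assms in simp_all)
  finally have "ennreal (1 / \<bar>c\<bar>) = ennreal (1 / \<bar>c\<bar>) * (\<bar>c\<bar> * (\<integral>\<^sup>+x. heat_kernel \<epsilon> (k + c * x) \<partial>lborel))"
    by simp
  also have "\<dots> = (\<integral>\<^sup>+x. heat_kernel \<epsilon> (k + c * x) \<partial>lborel)"
    using assms by (simp add: mult.assoc[symmetric] ennreal_mult[symmetric])
  finally show ?thesis ..
qed

text \<open>Real part of the characteristic function of the standard normal law.\<close>

lemma integral_cos_std_normal:
  "(\<integral>u. std_normal_density u * cos (t * u) \<partial>lborel) = exp (- (t\<^sup>2) / 2)"
proof -
  have "complex_of_real (exp (- (t\<^sup>2) / 2)) = (CLINT x|std_normal_distribution. iexp (t * x))"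
    using char_std_normal_distribution by (simp add: char_def fun_eq_iff)
  also have "\<dots> = (CLINT x|lborel. std_normal_density x *\<^sub>R iexp (t * x))"
    by (subst integral_density) auto
  finally have "exp (- (t\<^sup>2) / 2) = Re (CLINT x|lborel. std_normal_density x *\<^sub>R iexp (t * x))"
    by (metis Re_complex_of_real)
  also have "\<dots> = (\<integral>x. Re (std_normal_density x *\<^sub>R iexp (t * x)) \<partial>lborel)"
  proof (subst integral_Re)
    show "complex_integrable lborel (\<lambda>x. std_normal_density x *\<^sub>R iexp (t * x))"
      by (rule Bochner_Integration.integrable_bound[OF integrable_normal_density[of 1 0]]) (auto simp: norm_mult)
  qed simp
  finally show ?thesis by (simp add: cis_conv_exp[symmetric] Re_exp del: of_real_mult)
qed

text \<open>Up to scaling the Gaussian is its own Fourier transform. Substituting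
  \<open>u = sqrt \<epsilon> * v\<close> moves \<open>\<epsilon>\<close> from the argument of the
  cosine into the Gaussian weight, where the dependence on \<open>\<epsilon>\<close> is
  monotone.\<close>

lemma heat_kernel_fourier:
  assumes "0 < \<epsilon>"
  shows "heat_kernel \<epsilon> x = (\<integral>v. exp (- \<epsilon> * v\<^sup>2 / 2) * cos (v * x) \<partial>lborel) / (2 * pi)"
proof -
  have "exp (- x\<^sup>2 / (2 * \<epsilon>)) = (\<integral>u. std_normal_density u * cos ((x / sqrt \<epsilon>) * u) \<partial>lborel)"
    using assms by (subst integral_cos_std_normal) (simp add: power_divide field_simps)
  also have "\<dots> = \<bar>sqrt \<epsilon>\<bar> *\<^sub>R (\<integral>v. std_normal_density (0 + sqrt \<epsilon> * v) * cos ((x / sqrt \<epsilon>) * (0 + sqrt \<epsilon> * v)) \<partial>lborel)"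
    by (rule lborel_integral_real_affine) (use assms in simp)
  also have "(\<lambda>v. std_normal_density (0 + sqrt \<epsilon> * v) * cos ((x / sqrt \<epsilon>) * (0 + sqrt \<epsilon> * v)))
      = (\<lambda>v. 1 / sqrt (2 * pi) * (exp (- \<epsilon> * v\<^sup>2 / 2) * cos (v * x)))"
    using assms by (auto simp: std_normal_density_def power_mult_distrib ac_simps)
  finally have *: "exp (- x\<^sup>2 / (2 * \<epsilon>)) = sqrt \<epsilon> * (1 / sqrt (2 * pi) * (\<integral>v. exp (- \<epsilon> * v\<^sup>2 / 2) * cos (v * x) \<partial>lborel))"
    using assms by simp
  have "heat_kernel \<epsilon> x = exp (- x\<^sup>2 / (2 * \<epsilon>)) / (sqrt (2 * pi) * sqrt \<epsilon>)"
    by (simp add: heat_kernel_def real_sqrt_mult)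
  also have "\<dots> = (\<integral>v. exp (- \<epsilon> * v\<^sup>2 / 2) * cos (v * x) \<partial>lborel) / (sqrt (2 * pi) * sqrt (2 * pi))"
    unfolding * using assms by simp
  finally show ?thesis by simp
qed

lemma integrable_exp_neg_square:
  assumes "0 < (\<epsilon>::real)"
  shows "integrable lborel (\<lambda>v. exp (- \<epsilon> * v\<^sup>2 / 2))"
proof -
  have "integrable lborel (\<lambda>v. sqrt (2 * pi / \<epsilon>) * normal_density 0 (1 / sqrt \<epsilon>) v)"
    using assms by (intro integrable_mult_right integrable_normal_density) simp
  also have "(\<lambda>v. sqrt (2 * pi / \<epsilon>) * normal_density 0 (1 / sqrt \<epsilon>) v) = (\<lambda>v. exp (- \<epsilon> * v\<^sup>2 / 2))"
    using assms by (auto simp: normal_density_def power_divide fun_eq_iff)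
  finally show ?thesis .
qed

context finite_measure
begin

text \<open>Fubini moves the frequency integral outside, and the addition formula for the cosine
  turns the remaining double integral into two squares. Their sum is the squared modulus of the
  integral of exp(i v f), hence nonnegative.\<close>

lemma heat_kernel_energy_fourier:
  fixes f :: "'a \<Rightarrow> real"
  assumes [measurable]: "f \<in> borel_measurable M" and \<epsilon>: "0 < \<epsilon>"
  shows "(\<integral>t. \<integral>s. heat_kernel \<epsilon> (f t - f s) \<partial>M \<partial>M) =
    (\<integral>v. exp (- \<epsilon> * v\<^sup>2 / 2) * ((\<integral>t. cos (v * f t) \<partial>M)\<^sup>2 + (\<integral>t. sin (v * f t) \<partial>M)\<^sup>2) \<partial>lborel) / (2 * pi)"
proof -
  interpret P: pair_sigma_finite M M ..
  interpret PP: finite_measure "M \<Otimes>\<^sub>M M" by (intro finite_measure_pair_measure finite_measure_axioms)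
  interpret Q: pair_sigma_finite "M \<Otimes>\<^sub>M M" "lborel :: real measure" ..
  define h where "h = (\<lambda>p v. exp (- \<epsilon> * v\<^sup>2 / 2) * cos (v * (f (fst p) - f (snd p))))"
  have [measurable]: "case_prod h \<in> borel_measurable ((M \<Otimes>\<^sub>M M) \<Otimes>\<^sub>M lborel)"
    unfolding h_def by measurable
  \<comment> \<open>Fubini needs a dominating function: the cosine is at most 1 in modulus, and the
    Gaussian weight is integrable against a finite measure times Lebesgue measure.\<close>
  have G: "integrable ((M \<Otimes>\<^sub>M M) \<Otimes>\<^sub>M lborel) (\<lambda>(p::'a \<times> 'a, v::real). exp (- \<epsilon> * v\<^sup>2 / 2))"
    by (rule Q.Fubini_integrable) (use integrable_exp_neg_square[OF \<epsilon>] in auto)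
  have int: "integrable ((M \<Otimes>\<^sub>M M) \<Otimes>\<^sub>M lborel) (case_prod h)"
    by (rule Bochner_Integration.integrable_bound[OF G]) (auto simp: h_def abs_mult split: prod.splits)
  have bd: "integrable M g" if "g \<in> borel_measurable M" "\<And>x. \<bar>g x\<bar> \<le> B" for g :: "'a \<Rightarrow> real" and B
    using that by (intro integrable_const_bound[where B=B]) auto
  have "integrable (M \<Otimes>\<^sub>M M) (\<lambda>p. heat_kernel \<epsilon> (f (fst p) - f (snd p)))"
    using \<epsilon> heat_kernel_le[OF \<epsilon>] by (intro PP.integrable_const_bound[where B="1 / sqrt (2 * pi * \<epsilon>)"]) auto
  then have "(\<integral>t. \<integral>s. heat_kernel \<epsilon> (f t - f s) \<partial>M \<partial>M) = (\<integral>p. heat_kernel \<epsilon> (f (fst p) - f (snd p)) \<partial>(M \<Otimes>\<^sub>M M))"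
    by (subst P.integral_fst'[symmetric]) simp_all
  also have "\<dots> = (\<integral>p. (\<integral>v. h p v \<partial>lborel) \<partial>(M \<Otimes>\<^sub>M M)) / (2 * pi)"
    by (simp add: heat_kernel_fourier[OF \<epsilon>] h_def)
  also have "(\<integral>p. (\<integral>v. h p v \<partial>lborel) \<partial>(M \<Otimes>\<^sub>M M)) = (\<integral>v. (\<integral>p. h p v \<partial>(M \<Otimes>\<^sub>M M)) \<partial>lborel)"
    by (rule Q.Fubini_integral[symmetric]) (rule int)
  also have "(\<lambda>v. \<integral>p. h p v \<partial>(M \<Otimes>\<^sub>M M)) = (\<lambda>v. exp (- \<epsilon> * v\<^sup>2 / 2) * ((\<integral>t. cos (v * f t) \<partial>M)\<^sup>2 + (\<integral>t. sin (v * f t) \<partial>M)\<^sup>2))"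
  proof
    fix v :: real
    have c: "integrable M (\<lambda>t. cos (v * f t))" and s: "integrable M (\<lambda>t. sin (v * f t))"
      by (auto intro: bd[where B=1])
    have "(\<integral>p. h p v \<partial>(M \<Otimes>\<^sub>M M)) = exp (- \<epsilon> * v\<^sup>2 / 2) * (\<integral>p. cos (v * (f (fst p) - f (snd p))) \<partial>(M \<Otimes>\<^sub>M M))"
      by (simp add: h_def)
    also have "(\<integral>p. cos (v * (f (fst p) - f (snd p))) \<partial>(M \<Otimes>\<^sub>M M)) = (\<integral>t. \<integral>s. cos (v * (f t - f s)) \<partial>M \<partial>M)"
      by (subst P.integral_fst'[symmetric]) (auto intro!: PP.integrable_const_bound[where B=1])
    also have "\<dots> = (\<integral>t. \<integral>s. cos (v * f t) * cos (v * f s) + sin (v * f t) * sin (v * f s) \<partial>M \<partial>M)"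
      by (simp add: right_diff_distrib cos_diff)
    also have "\<dots> = (\<integral>t. cos (v * f t) \<partial>M)\<^sup>2 + (\<integral>t. sin (v * f t) \<partial>M)\<^sup>2"
      using c s by (simp add: power2_eq_square)
    finally show "(\<integral>p. h p v \<partial>(M \<Otimes>\<^sub>M M)) = exp (- \<epsilon> * v\<^sup>2 / 2) * ((\<integral>t. cos (v * f t) \<partial>M)\<^sup>2 + (\<integral>t. sin (v * f t) \<partial>M)\<^sup>2)" .
  qed
  finally show ?thesis .
qed

text \<open>For fixed x \<noteq> 0 the kernel is not monotone in \<open>\<epsilon>\<close>: it first
  grows and then decays. Monotonicity appears only after the double integration, where
  \<open>\<epsilon>\<close> survives in the weight \<open>exp (- \<epsilon> * v\<^sup>2 / 2)\<close>
  alone, against a nonnegative factor.\<close>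

lemma heat_kernel_energy_antimono:
  fixes f :: "'a \<Rightarrow> real"
  assumes [measurable]: "f \<in> borel_measurable M" and "0 < \<delta>" "\<delta> \<le> \<epsilon>"
  shows "(\<integral>t. \<integral>s. heat_kernel \<epsilon> (f t - f s) \<partial>M \<partial>M) \<le> (\<integral>t. \<integral>s. heat_kernel \<delta> (f t - f s) \<partial>M \<partial>M)"
proof -
  define F where "F = (\<lambda>v. (\<integral>t. cos (v * f t) \<partial>M)\<^sup>2 + (\<integral>t. sin (v * f t) \<partial>M)\<^sup>2)"
  have [measurable]: "F \<in> borel_measurable borel"
    unfolding F_def by measurable
  have bd: "\<bar>\<integral>t. g t \<partial>M\<bar> \<le> measure M (space M)" if "\<And>t. \<bar>g t\<bar> \<le> 1" "g \<in> borel_measurable M" for g :: "'a \<Rightarrow> real"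
  proof -
    have "\<bar>\<integral>t. g t \<partial>M\<bar> \<le> (\<integral>t. \<bar>g t\<bar> \<partial>M)" by (rule integral_abs_bound)
    also have "\<dots> \<le> (\<integral>t. 1 \<partial>M)"
      using that by (intro integral_mono integrable_const_bound[where B=1]) auto
    finally show ?thesis by simp
  qed
  have F0: "0 \<le> F v" for v by (simp add: F_def)
  have F1: "F v \<le> (measure M (space M))\<^sup>2 + (measure M (space M))\<^sup>2" for v
    unfolding F_def by (intro add_mono power2_le_iff_abs_le[THEN iffD2] bd) auto
  have int: "integrable lborel (\<lambda>v. exp (- \<epsilon> * v\<^sup>2 / 2) * F v)" if "0 < \<epsilon>" for \<epsilon>
    by (rule Bochner_Integration.integrable_bound[OF integrable_mult_left[OF integrable_exp_neg_square[OF that], of "(measure M (space M))\<^sup>2 + (measure M (space M))\<^sup>2"]])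
       (use F0 F1 in \<open>auto simp: abs_mult\<close>)
  have "(\<integral>v. exp (- \<epsilon> * v\<^sup>2 / 2) * F v \<partial>lborel) \<le> (\<integral>v. exp (- \<delta> * v\<^sup>2 / 2) * F v \<partial>lborel)"
    using assms by (intro integral_mono int mult_right_mono F0) (auto intro!: mult_right_mono)
  with assms show ?thesis
    unfolding F_def by (simp add: heat_kernel_energy_fourier divide_right_mono)
qed

end

section \<open>Second moments of bridge increments\<close>

text \<open>This is Beta(1/2, 1/2) = \<pi> on the unit interval. Under s = x + d t the product under
  the root becomes d^2 t (1 - t), so the root cancels the Jacobian d and the value does not depend
  on the interval.\<close>

lemma nn_integral_arcsine:  assumes "(x::real) < y"
  shows "(\<integral>\<^sup>+s. ennreal (1 / sqrt ((s - x) * (y - s))) * indicator {x<..<y} s \<partial>lborel) = ennreal pi"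
proof -
  define d where "d = y - x"
  have d: "d > 0" using assms by (simp add: d_def)
  have "Beta (1/2) (1/2 :: real) = pi"
    by (simp add: Beta_def Gamma_one_half_real)
  then have "((\<lambda>t. t powr (1/2 - 1) * (1 - t) powr (1/2 - 1)) has_integral pi) {0..1::real}"
    using has_integral_Beta_real[of "1/2" "1/2"] by simp
  then have "((\<lambda>t. t powr (1/2 - 1) * (1 - t) powr (1/2 - 1)) has_integral pi) {0<..<1::real}"
    by (simp only: has_integral_Icc_iff_Ioo)
  then have "((\<lambda>t. 1 / sqrt (t * (1 - t))) has_integral pi) {0<..<1::real}"
    by (rule has_integral_eq[rotated]) (auto simp: powr_minus_divide powr_half_sqrt real_sqrt_mult)
  from nn_integral_has_integral_lebesgue'[OF _ this]
  have *: "(\<integral>\<^sup>+t. ennreal (1 / sqrt (t * (1 - t))) * indicator {0<..<1} t \<partial>lborel) = ennreal pi"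
    by simp
  have "(\<integral>\<^sup>+s. ennreal (1 / sqrt ((s - x) * (y - s))) * indicator {x<..<y} s \<partial>lborel) =
      \<bar>d\<bar> * (\<integral>\<^sup>+t. ennreal (1 / sqrt (((x + d * t) - x) * (y - (x + d * t)))) * indicator {x<..<y} (x + d * t) \<partial>lborel)"
    by (rule nn_integral_real_affine) (use d in auto)
  also have "\<dots> = (\<integral>\<^sup>+t. ennreal \<bar>d\<bar> * (ennreal (1 / sqrt (((x + d * t) - x) * (y - (x + d * t)))) * indicator {x<..<y} (x + d * t)) \<partial>lborel)"
    by (rule nn_integral_cmult[symmetric]) auto
  also have "\<dots> = (\<integral>\<^sup>+t. ennreal (1 / sqrt (t * (1 - t))) * indicator {0<..<1} t \<partial>lborel)"
  proof (intro nn_integral_cong)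
    fix t
    have ind: "indicator {x<..<y} (x + d * t) = (indicator {0<..<1} t :: ennreal)"
    proof -
      have "x + d * t < y \<longleftrightarrow> d * t < d * 1" using d_def by linarith
      also have "\<dots> \<longleftrightarrow> t < 1" using d by (rule mult_less_cancel_left_pos)
      finally show ?thesis using d by (simp add: indicator_def zero_less_mult_iff)
    qed
    have "((x + d * t) - x) * (y - (x + d * t)) = d^2 * (t * (1 - t))"
      by (simp add: d_def power2_eq_square algebra_simps)
    then have root: "sqrt (((x + d * t) - x) * (y - (x + d * t))) = d * sqrt (t * (1 - t))"
      using d by (simp only: real_sqrt_mult) simp
    have "ennreal \<bar>d\<bar> * ennreal (1 / (d * sqrt (t * (1 - t)))) = ennreal (1 / sqrt (t * (1 - t)))"
      if "t \<in> {0<..<1}"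
      using d that by (simp add: ennreal_mult'[symmetric] del: real_sqrt_mult)
    then show "ennreal \<bar>d\<bar> * (ennreal (1 / sqrt (((x + d * t) - x) * (y - (x + d * t)))) * indicator {x<..<y} (x + d * t)) = ennreal (1 / sqrt (t * (1 - t))) * indicator {0<..<1} t"
      unfolding ind root by (auto simp: indicator_def)
  qed
  finally show ?thesis using * by simp
qed

text \<open>Independence makes the joint law a product of normal laws. Expectations of functions of
  the increments thus become integrals over \<open>PiM\<close>, where coordinates can be integrated
  out one by one.\<close>

lemma indep_vars_normal_nn_integral:
  fixes N :: "nat \<Rightarrow> 'a \<Rightarrow> real" and \<sigma> :: "nat \<Rightarrow> real"
  assumes "prob_space M"
  assumes ind: "prob_space.indep_vars M (\<lambda>_. borel) N {..<n}" and n: "n \<noteq> 0"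
  assumes N: "\<And>i. i < n \<Longrightarrow> distributed M lborel (N i) (normal_density 0 (\<sigma> i))"
  assumes [measurable]: "g \<in> borel_measurable (PiM {..<n} (\<lambda>_. borel :: real measure))"
  shows "(\<integral>\<^sup>+\<omega>. g (\<lambda>i\<in>{..<n}. N i \<omega>) \<partial>M) =
    (\<integral>\<^sup>+x. g x \<partial>PiM {..<n} (\<lambda>i. density lborel (normal_density 0 (\<sigma> i))))"
proof -
  interpret prob_space M by fact
  have [measurable]: "N i \<in> borel_measurable M" if "i < n" for i
    using ind that by (auto simp: indep_vars_def)
  have m: "(\<lambda>\<omega>. \<lambda>i\<in>{..<n}. N i \<omega>) \<in> measurable M (PiM {..<n} (\<lambda>_. borel))"
    by (intro measurable_restrict) auto
  have "distr M (PiM {..<n} (\<lambda>_. borel)) (\<lambda>\<omega>. \<lambda>i\<in>{..<n}. N i \<omega>) = PiM {..<n} (\<lambda>i. distr M borel (N i))"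
    using ind n by (subst (asm) indep_vars_iff_distr_eq_PiM') auto
  \<comment> \<open>\<open>distributed\<close> speaks of the image measure over
    \<open>lborel\<close>, the product of the one over \<open>borel\<close>; both have the same
    sets, so the image measures agree.\<close>
  also have "\<dots> = PiM {..<n} (\<lambda>i. density lborel (normal_density 0 (\<sigma> i)))"
    using distributed_distr_eq_density[OF N]
    by (intro PiM_cong refl) (metis distr_cong lessThan_iff sets_lborel)
  finally have "distr M (PiM {..<n} (\<lambda>_. borel)) (\<lambda>\<omega>. \<lambda>i\<in>{..<n}. N i \<omega>) = \<dots>" .
  then show ?thesis
    by (subst nn_integral_distr[OF m, symmetric]) simp_all
qed

lemma nn_integral_normal_le:
  assumes "0 < \<sigma>" and [measurable]: "f \<in> borel_measurable borel"
  shows "(\<integral>\<^sup>+x. f x \<partial>density lborel (normal_density 0 \<sigma>)) \<le> ennreal (1 / (sqrt (2 * pi) * \<sigma>)) * (\<integral>\<^sup>+x. f x \<partial>lborel)"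
proof -
  have "(\<integral>\<^sup>+x. f x \<partial>density lborel (normal_density 0 \<sigma>)) = (\<integral>\<^sup>+x. normal_density 0 \<sigma> x * f x \<partial>lborel)"
    by (subst nn_integral_density) auto
  also have "\<dots> \<le> (\<integral>\<^sup>+x. ennreal (1 / (sqrt (2 * pi) * \<sigma>)) * f x \<partial>lborel)"
    using assms by (intro nn_integral_mono mult_right_mono ennreal_leI) (auto simp: normal_density_def real_sqrt_mult divide_simps)
  finally show ?thesis by (simp add: nn_integral_cmult)
qed

text \<open>The shear m = x + y has Jacobian 1. For fixed m, the variable y occurs only in the
  second kernel, with coefficient 1, and integrates to 1; the first kernel then contributes the
  inverse of its slope in m. The shifts and \<open>q\<close> disappear.\<close>

lemma nn_integral_heat_kernel_pair:
  assumes "0 < \<epsilon>" "\<theta> < 1"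
  shows "(\<integral>\<^sup>+x. \<integral>\<^sup>+y. heat_kernel \<epsilon> (k + (1 - \<theta>) * (x + y)) * heat_kernel \<epsilon> (l - q * (x + y) + y) \<partial>lborel \<partial>lborel)
    = ennreal (1 / (1 - \<theta>))"
proof -
  let ?h = "\<lambda>m y. ennreal (heat_kernel \<epsilon> (k + (1 - \<theta>) * m) * heat_kernel \<epsilon> (l - q * m + y))"
  have "(\<integral>\<^sup>+x. \<integral>\<^sup>+y. ?h (x + y) y \<partial>lborel \<partial>lborel) = (\<integral>\<^sup>+y. \<integral>\<^sup>+x. ?h (x + y) y \<partial>lborel \<partial>lborel)"
    by (rule lborel_pair.Fubini'[symmetric]) measurable
  also have "\<dots> = (\<integral>\<^sup>+y. \<integral>\<^sup>+m. ?h m y \<partial>lborel \<partial>lborel)"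
  proof (rule nn_integral_cong)
    fix y :: real
    show "(\<integral>\<^sup>+x. ?h (x + y) y \<partial>lborel) = (\<integral>\<^sup>+m. ?h m y \<partial>lborel)"
      using nn_integral_real_affine[of "\<lambda>m. ?h m y" 1 y] by (simp add: add.commute)
  qed
  also have "\<dots> = (\<integral>\<^sup>+m. \<integral>\<^sup>+y. ?h m y \<partial>lborel \<partial>lborel)"
    by (rule lborel_pair.Fubini') measurable
  also have "\<dots> = (\<integral>\<^sup>+m. heat_kernel \<epsilon> (k + (1 - \<theta>) * m) \<partial>lborel)"
  proof (rule nn_integral_cong)
    fix m :: real
    have "(\<integral>\<^sup>+y. ?h m y \<partial>lborel) = (\<integral>\<^sup>+y. ennreal (heat_kernel \<epsilon> (k + (1 - \<theta>) * m)) * ennreal (heat_kernel \<epsilon> ((l - q * m) + 1 * y)) \<partial>lborel)"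
      using assms by (simp add: ennreal_mult)
    also have "\<dots> = ennreal (heat_kernel \<epsilon> (k + (1 - \<theta>) * m)) * ennreal (1 / \<bar>1\<bar>)"
      using assms by (subst nn_integral_cmult) (simp_all only: nn_integral_heat_kernel_affine, auto)
    finally show "(\<integral>\<^sup>+y. ?h m y \<partial>lborel) = heat_kernel \<epsilon> (k + (1 - \<theta>) * m)"
      by simp
  qed
  also have "\<dots> = ennreal (1 / (1 - \<theta>))"
    using assms by (subst nn_integral_heat_kernel_affine) auto
  finally show ?thesis .
qed

text \<open>Once both increment densities are replaced by their maxima, the integral of the two
  kernels is computed exactly. The factor T / (T - (t - r)) is the inverse of the coefficient with
  which B_t - B_r enters X_t - X_r; it reflects the pinning at T.\<close>

lemma bridge_two_increments_bound:
  fixes B :: "real \<Rightarrow> 'a \<Rightarrow> real" and a b :: real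
  assumes B: "std_brownian_motion M B" and \<epsilon>: "0 < \<epsilon>" and rst: "0 < r" "r < s" "s < t" "t < T"
  defines "X \<equiv> brownian_bridge T a b B"
  shows "(\<integral>\<^sup>+\<omega>. heat_kernel \<epsilon> (X t \<omega> - X r \<omega>) * heat_kernel \<epsilon> (X t \<omega> - X s \<omega>) \<partial>M)
    \<le> ennreal (T / (2 * pi * (T - (t - r)) * sqrt ((s - r) * (t - s))))"
proof -
  have ps: "prob_space M" using B by (simp add: std_brownian_motion_def)
  interpret prob_space M by fact
  \<comment> \<open>Only the increments over \<open>[r, s]\<close> and \<open>[s, t]\<close> are integrated out; the remaining ones
    enter through \<open>z\<close>, which merely translates the kernels.\<close>
  define u :: "nat \<Rightarrow> real" where "u = (!) [0, r, s, t, T]"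
  define N where "N = (\<lambda>i \<omega>. B (u (Suc i)) \<omega> - B (u i) \<omega>)"
  \<comment> \<open>The value 1 from index 4 on makes every \<open>\<nu> i\<close> a probability
    measure, as \<open>product_prob_space\<close> concerns all indices.\<close>
  define \<sigma> where "\<sigma> = (\<lambda>i. if i < 4 then sqrt (u (Suc i) - u i) else 1)"
  define \<nu> where "\<nu> = (\<lambda>i. density lborel (normal_density 0 (\<sigma> i)))"
  have u_le: "0 \<le> u i" and u_less: "u i < u (Suc i)" if "i < 4" for i
    using that rst by (auto simp: u_def less_Suc_eq numeral_eq_Suc)
  have \<sigma>: "0 < \<sigma> i" for i using u_less[of i] by (simp add: \<sigma>_def)
  have N: "distributed M lborel (N i) (normal_density 0 (\<sigma> i))" if "i < 4" for i
    using B u_less[OF that] u_le[OF that] that by (simp add: std_brownian_motion_def N_def \<sigma>_def)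
  have ind: "indep_vars (\<lambda>_. borel) N {..<4}"
  proof -
    have "0 \<le> ts 0 \<longrightarrow> (\<forall>i<n. ts i < ts (Suc i)) \<longrightarrow>
        indep_vars (\<lambda>_. borel) (\<lambda>i \<omega>. B (ts (Suc i)) \<omega> - B (ts i) \<omega>) {..<n}" for n ts
      using B unfolding std_brownian_motion_def by (elim conjE allE)
    from this[of u 4] show ?thesis
      using u_less u_le[of 0] by (simp add: N_def)
  qed
  have B0: "B 0 \<omega> = 0" if "\<omega> \<in> space M" for \<omega>
    using that B by (simp add: std_brownian_motion_def)
  \<comment> \<open>These are the fractions of [0, T] covered by [r, t] and [s, t]. Writing B_T = z
    + x + y, with x and y the increments over [r, s] and [s, t], the pinning terms are \<theta> (z +
    x + y) and q (z + x + y), which gives \<open>k\<close>, \<open>l\<close> and \<open>h\<close>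
    below.\<close>
  define \<theta> where "\<theta> = (t - r) / T"
  define q where "q = (t - s) / T"
  have T: "0 < T" using rst by simp
  interpret product_prob_space \<nu>
    unfolding product_prob_space_def product_sigma_finite_def product_prob_space_axioms_def \<nu>_def
    using prob_space_normal_density[OF \<sigma>] by (auto intro: prob_space_imp_sigma_finite)
  interpret J: prob_space "PiM {0, 3} \<nu>"
    by (rule prob_space_PiM) (simp add: \<nu>_def prob_space_normal_density \<sigma>)
  have [measurable_cong, simp]: "sets (\<nu> i) = sets borel" for i
    by (simp add: \<nu>_def)
  have \<theta>: "\<theta> < 1" using rst by (simp add: \<theta>_def)
  define k where "k = (\<lambda>z. (b - a) * \<theta> - \<theta> * z)"
  define l where "l = (\<lambda>z. (b - a) * q - q * z)"
  define h where "h = (\<lambda>z x y. heat_kernel \<epsilon> (k z + (1 - \<theta>) * (x + y)) * heat_kernel \<epsilon> (l z - q * (x + y) + y))"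
  have [measurable]: "(\<lambda>p. h (f p) (g p) (g' p)) \<in> borel_measurable L"
    if "f \<in> borel_measurable L" "g \<in> borel_measurable L" "g' \<in> borel_measurable L"
    for f g g' :: "'b \<Rightarrow> real" and L
    using that unfolding h_def k_def l_def by measurable
  have h_integral: "(\<integral>\<^sup>+x. \<integral>\<^sup>+y. h z x y \<partial>lborel \<partial>lborel) = ennreal (1 / (1 - \<theta>))" for z
    unfolding h_def by (rule nn_integral_heat_kernel_pair[OF \<epsilon> \<theta>])
  have "(\<integral>\<^sup>+\<omega>. heat_kernel \<epsilon> (X t \<omega> - X r \<omega>) * heat_kernel \<epsilon> (X t \<omega> - X s \<omega>) \<partial>M)
    = (\<integral>\<^sup>+\<omega>. h (N 0 \<omega> + N 3 \<omega>) (N 1 \<omega>) (N 2 \<omega>) \<partial>M)"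
  proof (rule nn_integral_cong)
    fix \<omega> assume \<omega>: "\<omega> \<in> space M"
    have "X t \<omega> - X r \<omega> = k (N 0 \<omega> + N 3 \<omega>) + (1 - \<theta>) * (N 1 \<omega> + N 2 \<omega>)"
         "X t \<omega> - X s \<omega> = l (N 0 \<omega> + N 3 \<omega>) - q * (N 1 \<omega> + N 2 \<omega>) + N 2 \<omega>"
      using T B0[OF \<omega>]
      by (simp_all add: X_def brownian_bridge_def k_def l_def N_def u_def \<theta>_def q_def numeral_eq_Suc field_simps)
    then show "ennreal (heat_kernel \<epsilon> (X t \<omega> - X r \<omega>) * heat_kernel \<epsilon> (X t \<omega> - X s \<omega>)) = ennreal (h (N 0 \<omega> + N 3 \<omega>) (N 1 \<omega>) (N 2 \<omega>))"
      by (simp add: h_def)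
  qed
  also have "\<dots> = (\<integral>\<^sup>+\<omega>. (\<lambda>x. h (x 0 + x 3) (x 1) (x 2)) (\<lambda>i\<in>{..<4}. N i \<omega>) \<partial>M)"
    by simp
  also have "\<dots> = (\<integral>\<^sup>+x. h (x 0 + x 3) (x 1) (x 2) \<partial>PiM {..<4} \<nu>)"
    unfolding \<nu>_def by (rule indep_vars_normal_nn_integral[OF ps ind _ N]) auto
  \<comment> \<open>Inserting 1 and 2 last makes them the inner integrals, with the coordinates
    entering z outermost.\<close>
  also have "{..<4::nat} = insert 2 (insert 1 {0, 3})"
    by auto
  also have "(\<integral>\<^sup>+x. h (x 0 + x 3) (x 1) (x 2) \<partial>PiM (insert 2 (insert 1 {0, 3})) \<nu>)
    = (\<integral>\<^sup>+z. \<integral>\<^sup>+x. \<integral>\<^sup>+y. h (z 0 + z 3) x y \<partial>\<nu> 2 \<partial>\<nu> 1 \<partial>PiM {0, 3} \<nu>)"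
  proof (subst product_nn_integral_insert)
    show "(\<integral>\<^sup>+x. \<integral>\<^sup>+y. h ((x(2 := y)) 0 + (x(2 := y)) 3) ((x(2 := y)) 1) ((x(2 := y)) 2) \<partial>\<nu> 2 \<partial>PiM (insert 1 {0, 3}) \<nu>)
      = (\<integral>\<^sup>+z. \<integral>\<^sup>+x. \<integral>\<^sup>+y. h (z 0 + z 3) x y \<partial>\<nu> 2 \<partial>\<nu> 1 \<partial>PiM {0, 3} \<nu>)"
      by (subst product_nn_integral_insert) auto
  qed auto
  also have "\<dots> \<le> (\<integral>\<^sup>+z. ennreal (1 / (2 * pi * \<sigma> 1 * \<sigma> 2 * (1 - \<theta>))) \<partial>PiM {0, 3} \<nu>)"
  proof (rule nn_integral_mono)
    fix z :: "nat \<Rightarrow> real"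
    have "(\<integral>\<^sup>+x. \<integral>\<^sup>+y. h (z 0 + z 3) x y \<partial>\<nu> 2 \<partial>\<nu> 1)
      \<le> (\<integral>\<^sup>+x. ennreal (1 / (sqrt (2 * pi) * \<sigma> 2)) * (\<integral>\<^sup>+y. h (z 0 + z 3) x y \<partial>lborel) \<partial>\<nu> 1)"
      unfolding \<nu>_def by (intro nn_integral_mono nn_integral_normal_le \<sigma>) auto
    also have "\<dots> \<le> ennreal (1 / (sqrt (2 * pi) * \<sigma> 1)) *
        (\<integral>\<^sup>+x. ennreal (1 / (sqrt (2 * pi) * \<sigma> 2)) * (\<integral>\<^sup>+y. h (z 0 + z 3) x y \<partial>lborel) \<partial>lborel)"
      unfolding \<nu>_def by (intro nn_integral_normal_le \<sigma>) auto
    also have "\<dots> = ennreal (1 / (sqrt (2 * pi) * \<sigma> 1)) * (ennreal (1 / (sqrt (2 * pi) * \<sigma> 2)) * ennreal (1 / (1 - \<theta>)))"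
      by (subst nn_integral_cmult) (auto simp: h_integral)
    also have "\<dots> = ennreal (1 / (2 * pi * \<sigma> 1 * \<sigma> 2 * (1 - \<theta>)))"
    proof -
      have "1 / (sqrt (2 * pi) * \<sigma> 1) * (1 / (sqrt (2 * pi) * \<sigma> 2) * (1 / (1 - \<theta>)))
          = 1 / ((sqrt (2 * pi) * sqrt (2 * pi)) * \<sigma> 1 * \<sigma> 2 * (1 - \<theta>))"
        by (simp only: times_divide_times_eq mult_1 ac_simps)
      also have "sqrt (2 * pi) * sqrt (2 * pi) = 2 * pi"
        by simp
      finally show ?thesis
        using \<sigma>[of 1] \<sigma>[of 2] \<theta> by (simp add: ennreal_mult[symmetric] del: real_sqrt_mult_self)
    qed
    finally show "(\<integral>\<^sup>+x. \<integral>\<^sup>+y. h (z 0 + z 3) x y \<partial>\<nu> 2 \<partial>\<nu> 1) \<le> ennreal (1 / (2 * pi * \<sigma> 1 * \<sigma> 2 * (1 - \<theta>)))" .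
  qed
  \<comment> \<open>The bound is constant in z, and z runs through a probability space.\<close>
  also have "\<dots> = ennreal (1 / (2 * pi * \<sigma> 1 * \<sigma> 2 * (1 - \<theta>)))"
    using J.emeasure_space_1 by simp
  also have "1 / (2 * pi * \<sigma> 1 * \<sigma> 2 * (1 - \<theta>)) = T / (2 * pi * (T - (t - r)) * sqrt ((s - r) * (t - s)))"
  proof -
    have "1 - \<theta> = (T - (t - r)) / T" using T by (simp add: \<theta>_def field_simps)
    then show ?thesis
      by (simp add: \<sigma>_def u_def numeral_eq_Suc real_sqrt_mult mult_ac)
  qed
  finally show ?thesis .
qed

section \<open>Self-intersection energy of a deterministic path\<close>

text \<open>A density on the whole line, rather than a restricted space, keeps the sets
  \<open>borel\<close>: measurability stays global, while the measure is finite, as the energy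
  lemmas require.\<close>

definition time_measure :: "real \<Rightarrow> real measure" where
  "time_measure T = density lborel (\<lambda>t. ennreal (indicator {0..T} t))"

lemma sets_time_measure [simp, measurable_cong]: "sets (time_measure T) = sets borel"
  by (simp add: time_measure_def)

lemma space_time_measure [simp]: "space (time_measure T) = UNIV"
  by (simp add: time_measure_def)

lemma nn_integral_time_measure:
  "f \<in> borel_measurable borel \<Longrightarrow> (\<integral>\<^sup>+t. f t \<partial>time_measure T) = (\<integral>\<^sup>+t. indicator {0..T} t * f t \<partial>lborel)"
  by (simp add: time_measure_def nn_integral_density ennreal_indicator)

lemma integral_time_measure:
  fixes f :: "real \<Rightarrow> real"
  shows "f \<in> borel_measurable borel \<Longrightarrow> (\<integral>t. f t \<partial>time_measure T) = (LBINT t:{0..T}. f t)"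
  unfolding time_measure_def set_lebesgue_integral_def by (subst integral_density) auto

lemma AE_time_measure:
  "AE t in lborel. t \<in> {0..T} \<longrightarrow> P t \<Longrightarrow> AE t in time_measure T. P t"
  unfolding time_measure_def by (subst AE_density) (auto elim!: eventually_mono split: split_indicator_asm)

lemma emeasure_time_measure [simp]: "0 \<le> T \<Longrightarrow> emeasure (time_measure T) UNIV = ennreal T"
  by (simp add: time_measure_def emeasure_density ennreal_indicator)

lemma finite_measure_time_measure: "finite_measure (time_measure T)"
proof
  have "emeasure (time_measure T) (space (time_measure T)) = emeasure lborel {0..T}"
    by (simp add: time_measure_def emeasure_density ennreal_indicator)
  then show "emeasure (time_measure T) (space (time_measure T)) \<noteq> \<infinity>"
    by (cases "0 \<le> T") auto
qed

interpretation time_measure: finite_measure "time_measure T" for T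
  by (rule finite_measure_time_measure)

interpretation time_pair: pair_sigma_finite "time_measure T" "time_measure T" for T ..

interpretation time_pair: finite_measure "time_measure T \<Otimes>\<^sub>M time_measure T" for T
  by (intro finite_measure_pair_measure finite_measure_time_measure)

lemma nn_integral_time_measure_le:
  "f \<in> borel_measurable borel \<Longrightarrow> (\<integral>\<^sup>+t. f t \<partial>time_measure T) \<le> (\<integral>\<^sup>+t. f t \<partial>lborel)"
  by (subst nn_integral_time_measure) (auto intro!: nn_integral_mono split: split_indicator)

definition self_energy :: "real \<Rightarrow> (real \<Rightarrow> real) \<Rightarrow> real \<Rightarrow> real" where
  "self_energy T f \<epsilon> = (LBINT t:{0..T}. LBINT s:{0..t}. heat_kernel \<epsilon> (f t - f s))"

context
  fixes f :: "real \<Rightarrow> real" and \<epsilon> T :: real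
  assumes f [measurable]: "f \<in> borel_measurable borel" and \<epsilon>: "0 < \<epsilon>"
begin

private abbreviation (input) "K \<equiv> time_measure T"
private abbreviation (input) "k t s \<equiv> (if s \<le> t then heat_kernel \<epsilon> (f t - f s) else 0)"

private lemma k_bounds: "0 \<le> k t s" "k t s \<le> 1 / sqrt (2 * pi * \<epsilon>)"
  using \<epsilon> heat_kernel_le[OF \<epsilon>, of "f t - f s"] by auto

private lemma integrable_k: "integrable K (\<lambda>s. k t s)"
  using k_bounds by (intro time_measure.integrable_const_bound[where B="1 / sqrt (2 * pi * \<epsilon>)"]) auto

private lemma integrable_k_pair: "integrable (K \<Otimes>\<^sub>M K) (\<lambda>(t, s). k t s)"
  using k_bounds by (intro time_pair.integrable_const_bound[where B="1 / sqrt (2 * pi * \<epsilon>)"]) auto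

text \<open>The triangle s \<le> t moves into the integrand, so that both variables range over the
  same measure and can be exchanged.\<close>

lemma self_energy_time_measure: "self_energy T f \<epsilon> = (\<integral>t. \<integral>s. k t s \<partial>K \<partial>K)"
proof -
  have "(\<integral>t. \<integral>s. k t s \<partial>K \<partial>K) = (LBINT t:{0..T}. \<integral>s. k t s \<partial>K)"
    by (rule integral_time_measure) measurable
  also have "\<dots> = (LBINT t:{0..T}. LBINT s:{0..T}. k t s)"
    by (simp add: integral_time_measure)
  also have "\<dots> = (LBINT t:{0..T}. LBINT s:{0..t}. heat_kernel \<epsilon> (f t - f s))"
    unfolding set_lebesgue_integral_def
    by (intro Bochner_Integration.integral_cong refl) (auto split: split_indicator intro!: Bochner_Integration.integral_cong)
  finally show ?thesis
    by (simp add: self_energy_def)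
qed

lemma nn_integral_self_energy: "ennreal (self_energy T f \<epsilon>) = (\<integral>\<^sup>+t. \<integral>\<^sup>+s. k t s \<partial>K \<partial>K)"
proof -
  have "(\<integral>\<^sup>+t. \<integral>\<^sup>+s. k t s \<partial>K \<partial>K) = (\<integral>\<^sup>+t. ennreal (\<integral>s. k t s \<partial>K) \<partial>K)"
    using k_bounds by (intro nn_integral_cong nn_integral_eq_integral integrable_k) auto
  also have "\<dots> = ennreal (\<integral>t. \<integral>s. k t s \<partial>K \<partial>K)"
    using k_bounds time_pair.integrable_fst'[OF integrable_k_pair]
    by (intro nn_integral_eq_integral) (auto intro!: integral_nonneg_AE)
  finally show ?thesis by (simp add: self_energy_time_measure)
qed

lemma self_energy_nonneg: "0 \<le> self_energy T f \<epsilon>"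
  unfolding self_energy_time_measure using k_bounds by (intro integral_nonneg_AE AE_I2) auto

text \<open>The kernel is even, so the triangles above and below the diagonal contribute equally.
  This brings the energy to the full square, the setting of the Fourier formula.\<close>

lemma self_energy_symmetric: "2 * self_energy T f \<epsilon> = (\<integral>t. \<integral>s. heat_kernel \<epsilon> (f t - f s) \<partial>K \<partial>K)"
proof -
  have swap: "integrable (K \<Otimes>\<^sub>M K) (\<lambda>(t, s). k s t)"
    using k_bounds by (intro time_pair.integrable_const_bound[where B="1 / sqrt (2 * pi * \<epsilon>)"]) auto
  have "self_energy T f \<epsilon> = (\<integral>t. \<integral>s. k s t \<partial>K \<partial>K)"
    unfolding self_energy_time_measure by (rule time_pair.Fubini_integral) (rule swap)
  then have "2 * self_energy T f \<epsilon> = (\<integral>t. \<integral>s. k t s \<partial>K \<partial>K) + (\<integral>t. \<integral>s. k s t \<partial>K \<partial>K)"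
    by (simp add: self_energy_time_measure)
  also have "\<dots> = (\<integral>t. (\<integral>s. k t s \<partial>K) + (\<integral>s. k s t \<partial>K) \<partial>K)"
    using time_pair.integrable_fst'[OF integrable_k_pair] time_pair.integrable_fst'[OF swap]
    by (intro Bochner_Integration.integral_add[symmetric]) auto
  also have "\<dots> = (\<integral>t. \<integral>s. heat_kernel \<epsilon> (f t - f s) \<partial>K \<partial>K)"
  proof (intro Bochner_Integration.integral_cong refl)
    fix t
    have "integrable K (\<lambda>s. k s t)"
      using k_bounds by (intro time_measure.integrable_const_bound[where B="1 / sqrt (2 * pi * \<epsilon>)"]) auto
    then have "(\<integral>s. k t s \<partial>K) + (\<integral>s. k s t \<partial>K) = (\<integral>s. k t s + k s t \<partial>K)"
      by (intro Bochner_Integration.integral_add[symmetric] integrable_k)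
    also have "\<dots> = (\<integral>s. heat_kernel \<epsilon> (f t - f s) \<partial>K)"
    proof (rule integral_cong_AE)
      \<comment> \<open>At s = t both triangles count the kernel, so the identity holds only off
        this null set.\<close>
      have "AE s in lborel. s \<noteq> t" by (rule AE_lborel_singleton)
      then show "AE s in K. k t s + k s t = heat_kernel \<epsilon> (f t - f s)"
        by (intro AE_time_measure) (elim eventually_mono, auto simp: heat_kernel_minus)
    qed auto
    finally show "(\<integral>s. k t s \<partial>K) + (\<integral>s. k s t \<partial>K) = (\<integral>s. heat_kernel \<epsilon> (f t - f s) \<partial>K)" .
  qed
  finally show ?thesis .
qed

text \<open>Cauchy-Schwarz is applied in the outer variable only, against the constant 1. Instead of
  four times, only three remain, with t common to both kernels.\<close>

lemma self_energy_square_le: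
  assumes "0 \<le> T"
  shows "ennreal ((self_energy T f \<epsilon>)\<^sup>2) \<le> ennreal T * (\<integral>\<^sup>+t. \<integral>\<^sup>+s. \<integral>\<^sup>+r. k t s * k t r \<partial>K \<partial>K \<partial>K)"
proof -
  have "ennreal ((self_energy T f \<epsilon>)\<^sup>2) = (\<integral>\<^sup>+t. (\<integral>\<^sup>+s. k t s \<partial>K) * 1 \<partial>K)\<^sup>2"
    by (simp add: nn_integral_self_energy[symmetric] ennreal_power self_energy_nonneg)
  also have "\<dots> \<le> (\<integral>\<^sup>+t. (\<integral>\<^sup>+s. k t s \<partial>K)\<^sup>2 \<partial>K) * (\<integral>\<^sup>+t. 1\<^sup>2 \<partial>K)"
    by (rule Cauchy_Schwarz_nn_integral) measurable
  also have "(\<integral>\<^sup>+t. 1\<^sup>2 \<partial>K) = ennreal T"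
    using assms by simp
  also have "(\<integral>\<^sup>+t. (\<integral>\<^sup>+s. k t s \<partial>K)\<^sup>2 \<partial>K) = (\<integral>\<^sup>+t. \<integral>\<^sup>+s. \<integral>\<^sup>+r. k t s * k t r \<partial>K \<partial>K \<partial>K)"
    using k_bounds by (simp add: power2_eq_square ennreal_mult nn_integral_cmult nn_integral_multc)
  finally show ?thesis by (simp add: mult.commute)
qed

end

lemma self_energy_antimono:
  assumes "f \<in> borel_measurable borel" "0 < \<delta>" "\<delta> \<le> \<epsilon>"
  shows "self_energy T f \<epsilon> \<le> self_energy T f \<delta>"
proof -
  have "f \<in> borel_measurable (time_measure T)" using assms by simp
  from time_measure.heat_kernel_energy_antimono[OF this assms(2,3)] assms
  have "2 * self_energy T f \<epsilon> \<le> 2 * self_energy T f \<delta>"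
    by (simp add: self_energy_symmetric)
  then show ?thesis by simp
qed

section \<open>Measurability and the uniform second moment bound\<close>

text \<open>Rounding time down to multiples of 1/(n+1) leaves countably many values, so each
  discretised process is jointly measurable; continuity of paths gives pointwise convergence. Joint
  measurability is what Fubini between time and \<open>\<omega>\<close> requires.\<close>

lemma borel_measurable_continuous_process:
  fixes Y :: "real \<Rightarrow> 'a \<Rightarrow> real"
  assumes [measurable]: "\<And>t. Y t \<in> borel_measurable M"
    and cont: "\<And>\<omega>. \<omega> \<in> space M \<Longrightarrow> continuous_on UNIV (\<lambda>t. Y t \<omega>)"
  shows "(\<lambda>(t, \<omega>). Y t \<omega>) \<in> borel_measurable (borel \<Otimes>\<^sub>M M)"
proof (rule borel_measurable_LIMSEQ_real)
  define d where "d = (\<lambda>n t. real_of_int \<lfloor>real (Suc n) * t\<rfloor> / real (Suc n))"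
  have d: "(\<lambda>n. d n t) \<longlonglongrightarrow> t" for t
  proof (rule tendsto_sandwich)
    show "eventually (\<lambda>n. t - 1 / real (Suc n) \<le> d n t) sequentially"
    proof (intro always_eventually allI)
      fix n
      have "real (Suc n) * t - 1 \<le> real_of_int \<lfloor>real (Suc n) * t\<rfloor>" by linarith
      then have "(real (Suc n) * t - 1) / real (Suc n) \<le> d n t"
        unfolding d_def by (intro divide_right_mono) auto
      then show "t - 1 / real (Suc n) \<le> d n t"
        by (simp add: diff_divide_distrib)
    qed
    show "eventually (\<lambda>n. d n t \<le> t) sequentially"
    proof (intro always_eventually allI)
      fix n
      have "d n t \<le> (real (Suc n) * t) / real (Suc n)"
        unfolding d_def by (intro divide_right_mono) auto
      then show "d n t \<le> t" by simp
    qed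
    show "(\<lambda>n. t - 1 / real (Suc n)) \<longlonglongrightarrow> t"
      using tendsto_diff[OF tendsto_const LIMSEQ_inverse_real_of_nat, of t] by (simp add: inverse_eq_divide)
  qed simp
  show "(\<lambda>n. (\<lambda>(t, \<omega>). Y (d n t) \<omega>) p) \<longlonglongrightarrow> (\<lambda>(t, \<omega>). Y t \<omega>) p" if "p \<in> space (borel \<Otimes>\<^sub>M M)" for p
    using that continuous_on_tendsto_compose[OF cont d] by (auto simp: space_pair_measure)
  fix n
  have "(\<lambda>p. Y (real_of_int \<lfloor>real (Suc n) * fst p\<rfloor> / real (Suc n)) (snd p)) \<in> borel_measurable (borel \<Otimes>\<^sub>M M)"
    by (rule measurable_compose_countable[where g="\<lambda>p. \<lfloor>real (Suc n) * fst p\<rfloor>" and f="\<lambda>i p. Y (real_of_int i / real (Suc n)) (snd p)"]) measurable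
  then show "(\<lambda>(t, \<omega>). Y (d n t) \<omega>) \<in> borel_measurable (borel \<Otimes>\<^sub>M M)"
    by (simp add: d_def case_prod_unfold)
qed

text \<open>For fixed s this is a function of r times a function of t, supported on 0 < r < s < t <
  T. The 4 is 2 times the 2 from AM-GM, and \<open>r - 0\<close> matches the arcsine integral on (0,
  s).\<close>

definition bridge_bound :: "real \<Rightarrow> real \<Rightarrow> real \<Rightarrow> real \<Rightarrow> ennreal" where
  "bridge_bound T r s t = ennreal (T / (4 * pi)) *
    ((ennreal (1 / sqrt ((r - 0) * (s - r))) * indicator {0<..<s} r) *
     (ennreal (1 / sqrt ((t - s) * (T - t))) * indicator {s<..<T} t))"

lemma borel_measurable_bridge_bound [measurable (raw)]:
  assumes [measurable]: "f \<in> borel_measurable M" "g \<in> borel_measurable M" "h \<in> borel_measurable M"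
  shows "(\<lambda>x. bridge_bound T (f x) (g x) (h x)) \<in> borel_measurable M"
  unfolding bridge_bound_def indicator_def greaterThanLessThan_iff by measurable

text \<open>With s outermost, the integrals over r and t are arcsine integrals, each at most \<pi>.
  Integrating over s then gives T / (4 \<pi>) times \<pi>^2 times T.\<close>

lemma nn_integral_bridge_bound:
  assumes "0 < T"
  shows "(\<integral>\<^sup>+t. \<integral>\<^sup>+s. \<integral>\<^sup>+r. bridge_bound T r s t \<partial>time_measure T \<partial>time_measure T \<partial>time_measure T)
    \<le> ennreal (T\<^sup>2 * pi / 4)"
proof -
  define u where "u = (\<lambda>s r. ennreal (1 / sqrt ((r - 0) * (s - r))) * indicator {0<..<s} r)"
  define v where "v = (\<lambda>s t. ennreal (1 / sqrt ((t - s) * (T - t))) * indicator {s<..<T} t)"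
  let ?K = "time_measure T"
  have [measurable]: "(\<lambda>(s, r). u s r) \<in> borel_measurable (borel \<Otimes>\<^sub>M borel)"
    "(\<lambda>(s, t). v s t) \<in> borel_measurable (borel \<Otimes>\<^sub>M borel)"
    unfolding u_def v_def indicator_def greaterThanLessThan_iff by measurable
  have "(\<integral>\<^sup>+t. \<integral>\<^sup>+s. \<integral>\<^sup>+r. bridge_bound T r s t \<partial>?K \<partial>?K \<partial>?K) = (\<integral>\<^sup>+s. \<integral>\<^sup>+t. \<integral>\<^sup>+r. bridge_bound T r s t \<partial>?K \<partial>?K \<partial>?K)"
    by (rule time_pair.Fubini') measurable
  also have "\<dots> = (\<integral>\<^sup>+s. \<integral>\<^sup>+t. \<integral>\<^sup>+r. ennreal (T / (4 * pi)) * (u s r * v s t) \<partial>?K \<partial>?K \<partial>?K)"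
    by (simp only: bridge_bound_def u_def v_def)
  also have "\<dots> = ennreal (T / (4 * pi)) * (\<integral>\<^sup>+s. (\<integral>\<^sup>+r. u s r \<partial>?K) * (\<integral>\<^sup>+t. v s t \<partial>?K) \<partial>?K)"
    by (simp add: nn_integral_cmult nn_integral_multc)
  also have "(\<integral>\<^sup>+s. (\<integral>\<^sup>+r. u s r \<partial>?K) * (\<integral>\<^sup>+t. v s t \<partial>?K) \<partial>?K) \<le> (\<integral>\<^sup>+s. ennreal (pi * pi) \<partial>?K)"
  proof (rule nn_integral_mono_AE)
    \<comment> \<open>At the endpoints one of the two intervals is empty and the arcsine formula
      does not apply.\<close>
    have "AE s in lborel. s \<noteq> 0 \<and> s \<noteq> T"
      using AE_lborel_singleton[of 0] AE_lborel_singleton[of T] by eventually_elim simp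
    then have "AE s in ?K. 0 < s \<and> s < T"
      by (intro AE_time_measure) (elim eventually_mono, auto)
    then show "AE s in ?K. (\<integral>\<^sup>+r. u s r \<partial>?K) * (\<integral>\<^sup>+t. v s t \<partial>?K) \<le> ennreal (pi * pi)"
    proof eventually_elim
      fix s assume s: "0 < s \<and> s < T"
      have "(\<integral>\<^sup>+r. u s r \<partial>?K) \<le> ennreal pi"
        using nn_integral_time_measure_le[of "u s" T] nn_integral_arcsine[of 0 s] s by (simp add: u_def)
      moreover have "(\<integral>\<^sup>+t. v s t \<partial>?K) \<le> ennreal pi"
        using nn_integral_time_measure_le[of "v s" T] nn_integral_arcsine[of s T] s by (simp add: v_def)
      ultimately show "(\<integral>\<^sup>+r. u s r \<partial>?K) * (\<integral>\<^sup>+t. v s t \<partial>?K) \<le> ennreal (pi * pi)"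
        by (simp add: ennreal_mult mult_mono)
    qed
  qed
  also have "(\<integral>\<^sup>+s. ennreal (pi * pi) \<partial>?K) = ennreal (pi * pi) * ennreal T"
    using assms by simp
  also have "ennreal (T / (4 * pi)) * (ennreal (pi * pi) * ennreal T) = ennreal (T\<^sup>2 * pi / 4)"
    using assms by (simp add: ennreal_mult[symmetric] power2_eq_square)
  finally show ?thesis
    by (simp add: mult_left_mono)
qed

text \<open>AM-GM for r and T - t decouples r from t in the denominator.\<close>

lemma bridge_two_increments_le_bridge_bound:
  fixes B :: "real \<Rightarrow> 'a \<Rightarrow> real" and a b :: real
  assumes "std_brownian_motion M B" "0 < \<epsilon>" "0 < r" "r < s" "s < t" "t < T"
  defines "X \<equiv> brownian_bridge T a b B"
  shows "(\<integral>\<^sup>+\<omega>. heat_kernel \<epsilon> (X t \<omega> - X r \<omega>) * heat_kernel \<epsilon> (X t \<omega> - X s \<omega>) \<partial>M) \<le> bridge_bound T r s t"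
proof -
  have am: "2 * sqrt (r * (T - t)) \<le> T - (t - r)"
    using arith_geo_mean_sqrt[of r "T - t"] assms by simp
  have "T / (2 * pi * (T - (t - r)) * sqrt ((s - r) * (t - s)))
      \<le> T / (2 * pi * (2 * sqrt (r * (T - t))) * sqrt ((s - r) * (t - s)))"
    using assms by (intro divide_left_mono mult_right_mono mult_left_mono am mult_pos_pos) auto
  also have "\<dots> = T / (4 * pi) * (1 / sqrt ((r - 0) * (s - r)) * (1 / sqrt ((t - s) * (T - t))))"
    by (simp add: real_sqrt_mult)
  finally have "ennreal (T / (2 * pi * (T - (t - r)) * sqrt ((s - r) * (t - s)))) \<le> bridge_bound T r s t"
    using assms unfolding bridge_bound_def by (simp add: ennreal_mult[symmetric])
  then show ?thesis
    using bridge_two_increments_bound[OF assms(1-6), of a b] unfolding X_def by (rule order_trans[rotated])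
qed

locale brownian_bridge_setting = prob_space M for M :: "'a measure" +
  fixes B :: "real \<Rightarrow> 'a \<Rightarrow> real" and T a b :: real
  assumes B: "std_brownian_motion M B" and T: "0 < T"
begin

text \<open>Nothing is known about \<open>B t\<close> for \<open>t < 0\<close>; the clamped process has continuous paths on the whole line.\<close>

definition X :: "real \<Rightarrow> 'a \<Rightarrow> real" where
  "X = brownian_bridge T a b (\<lambda>t. B (max 0 t))"

lemma X_eq: "0 \<le> t \<Longrightarrow> X t \<omega> = brownian_bridge T a b B t \<omega>"
  using T by (simp add: X_def brownian_bridge_def)

lemma measurable_X:
  assumes [measurable]: "f \<in> borel_measurable L" "g \<in> measurable L M"
  shows "(\<lambda>x. X (f x) (g x)) \<in> borel_measurable L"
proof -
  have [measurable]: "(\<lambda>(t, \<omega>). B (max 0 t) \<omega>) \<in> borel_measurable (borel \<Otimes>\<^sub>M M)"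
  proof (rule borel_measurable_continuous_process)
    show "B (max 0 t) \<in> borel_measurable M" for t
      using B by (simp add: std_brownian_motion_def)
    show "continuous_on UNIV (\<lambda>t. B (max 0 t) \<omega>)" if "\<omega> \<in> space M" for \<omega>
    proof (rule continuous_on_compose2[where t="{0..}" and g="\<lambda>t. B t \<omega>"])
      show "continuous_on {0..} (\<lambda>t. B t \<omega>)"
        using B that by (simp add: std_brownian_motion_def)
    qed (auto intro!: continuous_intros)
  qed
  have [measurable]: "(\<lambda>x. B (max 0 (f x)) (g x)) \<in> borel_measurable L" if [measurable]: "f \<in> borel_measurable L" for f
  proof -
    have "(\<lambda>x. (\<lambda>(t, \<omega>). B (max 0 t) \<omega>) (f x, g x)) \<in> borel_measurable L"
      by measurable
    then show ?thesis by simp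
  qed
  show ?thesis
    unfolding X_def brownian_bridge_def by measurable
qed

declare measurable_X [measurable (raw)]

lemma measurable_X_path: "\<omega> \<in> space M \<Longrightarrow> (\<lambda>t. X t \<omega>) \<in> borel_measurable borel"
  by (rule measurable_X) auto

lemma approx_SILT_eq_self_energy: "approx_SILT T a b B \<epsilon> \<omega> = self_energy T (\<lambda>t. X t \<omega>) \<epsilon>"
  unfolding approx_SILT_def self_energy_def set_lebesgue_integral_def
  by (intro Bochner_Integration.integral_cong refl)
     (auto simp: X_eq split: split_indicator intro!: Bochner_Integration.integral_cong)

lemma measurable_approx_SILT [measurable]: "approx_SILT T a b B \<epsilon> \<in> borel_measurable M"
proof -
  have "(\<lambda>\<omega>. LBINT t. indicator {0..T} t *\<^sub>R (LBINT s. indicator {0..t} s *\<^sub>R heat_kernel \<epsilon> (X t \<omega> - X s \<omega>))) \<in> borel_measurable M"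
    unfolding indicator_def atLeastAtMost_iff by measurable
  then show ?thesis
    unfolding approx_SILT_eq_self_energy[abs_def] self_energy_def set_lebesgue_integral_def .
qed

text \<open>The product vanishes unless r and s both precede t. Each order of r and s is covered by
  one summand, the other being nonnegative.\<close>

lemma expected_kernel_pair_le:
  assumes "0 < \<epsilon>" "0 < t" "t < T" "0 < s" "0 < r" "s \<noteq> t" "r \<noteq> t" "r \<noteq> s"
  shows "(\<integral>\<^sup>+\<omega>. ennreal ((if s \<le> t then heat_kernel \<epsilon> (X t \<omega> - X s \<omega>) else 0) *
      (if r \<le> t then heat_kernel \<epsilon> (X t \<omega> - X r \<omega>) else 0)) \<partial>M) \<le> bridge_bound T r s t + bridge_bound T s r t"
proof -
  consider "s > t \<or> r > t" | "r < s" "s < t" | "s < r" "r < t" using assms by linarith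
  then show ?thesis
  proof cases
    case 1
    then show ?thesis by auto
  next
    case 2
    then show ?thesis
      using bridge_two_increments_le_bridge_bound[OF B, of \<epsilon> r s t T a b] assms
      by (auto simp: X_eq mult.commute intro: add_increasing2)
  next
    case 3
    then show ?thesis
      using bridge_two_increments_le_bridge_bound[OF B, of \<epsilon> s r t T a b] assms
      by (auto simp: X_eq intro: add_increasing)
  qed
qed

text \<open>The constant is T from Cauchy-Schwarz times T^2 \<pi> / 4 for each of the two orders of
  r and s. It is independent of \<open>\<epsilon>\<close>, which is the point.\<close>

lemma second_moment_approx_SILT_le:
  assumes \<epsilon>: "0 < \<epsilon>"
  shows "(\<integral>\<^sup>+\<omega>. ennreal ((approx_SILT T a b B \<epsilon> \<omega>)\<^sup>2) \<partial>M) \<le> ennreal (T ^ 3 * pi / 2)"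
proof -
  let ?K = "time_measure T"
  let ?k = "\<lambda>t s \<omega>. if s \<le> t then heat_kernel \<epsilon> (X t \<omega> - X s \<omega>) else 0"
  interpret Q: pair_sigma_finite ?K M ..
  have "(\<integral>\<^sup>+\<omega>. ennreal ((approx_SILT T a b B \<epsilon> \<omega>)\<^sup>2) \<partial>M)
      \<le> (\<integral>\<^sup>+\<omega>. ennreal T * (\<integral>\<^sup>+t. \<integral>\<^sup>+s. \<integral>\<^sup>+r. ?k t s \<omega> * ?k t r \<omega> \<partial>?K \<partial>?K \<partial>?K) \<partial>M)"
    unfolding approx_SILT_eq_self_energy using T
    by (intro nn_integral_mono self_energy_square_le[OF measurable_X_path \<epsilon>]) auto
  also have "\<dots> = ennreal T * (\<integral>\<^sup>+\<omega>. (\<integral>\<^sup>+t. \<integral>\<^sup>+s. \<integral>\<^sup>+r. ?k t s \<omega> * ?k t r \<omega> \<partial>?K \<partial>?K \<partial>?K) \<partial>M)"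
    by (rule nn_integral_cmult) measurable
  \<comment> \<open>Three exchanges carry the expectation inwards past t, s and r.\<close>
  also have "(\<integral>\<^sup>+\<omega>. (\<integral>\<^sup>+t. \<integral>\<^sup>+s. \<integral>\<^sup>+r. ?k t s \<omega> * ?k t r \<omega> \<partial>?K \<partial>?K \<partial>?K) \<partial>M)
      = (\<integral>\<^sup>+t. \<integral>\<^sup>+\<omega>. \<integral>\<^sup>+s. \<integral>\<^sup>+r. ?k t s \<omega> * ?k t r \<omega> \<partial>?K \<partial>?K \<partial>M \<partial>?K)"
    by (rule Q.Fubini') measurable
  also have "\<dots> = (\<integral>\<^sup>+t. \<integral>\<^sup>+s. \<integral>\<^sup>+\<omega>. \<integral>\<^sup>+r. ?k t s \<omega> * ?k t r \<omega> \<partial>?K \<partial>M \<partial>?K \<partial>?K)"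
    by (intro nn_integral_cong Q.Fubini') measurable
  also have "\<dots> = (\<integral>\<^sup>+t. \<integral>\<^sup>+s. \<integral>\<^sup>+r. \<integral>\<^sup>+\<omega>. ?k t s \<omega> * ?k t r \<omega> \<partial>M \<partial>?K \<partial>?K \<partial>?K)"
    by (intro nn_integral_cong Q.Fubini') measurable
  also have "\<dots> \<le> (\<integral>\<^sup>+t. \<integral>\<^sup>+s. \<integral>\<^sup>+r. bridge_bound T r s t + bridge_bound T s r t \<partial>?K \<partial>?K \<partial>?K)"
  proof -
    \<comment> \<open>The pair estimate needs distinct times inside (0, T). The exceptional points
      are null at each level, so the comparison proceeds from t to s to r.\<close>
    have ne: "AE x in ?K. x \<noteq> y" for y
      using AE_lborel_singleton[of y] by (intro AE_time_measure) (elim eventually_mono, auto)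
    have Icc: "AE x in ?K. 0 \<le> x \<and> x \<le> T"
      by (intro AE_time_measure) auto
    have "AE t in ?K. (\<integral>\<^sup>+s. \<integral>\<^sup>+r. \<integral>\<^sup>+\<omega>. ?k t s \<omega> * ?k t r \<omega> \<partial>M \<partial>?K \<partial>?K)
        \<le> (\<integral>\<^sup>+s. \<integral>\<^sup>+r. bridge_bound T r s t + bridge_bound T s r t \<partial>?K \<partial>?K)"
      using Icc ne[of 0] ne[of T]
    proof eventually_elim
      case t: (elim t)
      have "AE s in ?K. (\<integral>\<^sup>+r. \<integral>\<^sup>+\<omega>. ?k t s \<omega> * ?k t r \<omega> \<partial>M \<partial>?K)
        \<le> (\<integral>\<^sup>+r. bridge_bound T r s t + bridge_bound T s r t \<partial>?K)"
        using Icc ne[of 0] ne[of t]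
      proof eventually_elim
        case s: (elim s)
        have "AE r in ?K. (\<integral>\<^sup>+\<omega>. ?k t s \<omega> * ?k t r \<omega> \<partial>M) \<le> bridge_bound T r s t + bridge_bound T s r t"
          using Icc ne[of 0] ne[of t] ne[of s]
        proof eventually_elim
          case (elim r)
          with s t show ?case by (intro expected_kernel_pair_le \<epsilon>) auto
        qed
        then show ?case by (rule nn_integral_mono_AE)
      qed
      then show ?case by (rule nn_integral_mono_AE)
    qed
    then show ?thesis by (rule nn_integral_mono_AE)
  qed
  also have "\<dots> = (\<integral>\<^sup>+t. \<integral>\<^sup>+s. \<integral>\<^sup>+r. bridge_bound T r s t \<partial>?K \<partial>?K \<partial>?K)
      + (\<integral>\<^sup>+t. \<integral>\<^sup>+s. \<integral>\<^sup>+r. bridge_bound T s r t \<partial>?K \<partial>?K \<partial>?K)"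
    by (simp add: nn_integral_add)
  \<comment> \<open>Exchanging r and s turns the second integral into a renamed copy of the
    first.\<close>
  also have "(\<integral>\<^sup>+t. \<integral>\<^sup>+s. \<integral>\<^sup>+r. bridge_bound T s r t \<partial>?K \<partial>?K \<partial>?K) = (\<integral>\<^sup>+t. \<integral>\<^sup>+r. \<integral>\<^sup>+s. bridge_bound T s r t \<partial>?K \<partial>?K \<partial>?K)"
    by (intro nn_integral_cong time_pair.Fubini') measurable
  also have "(\<integral>\<^sup>+t. \<integral>\<^sup>+s. \<integral>\<^sup>+r. bridge_bound T r s t \<partial>?K \<partial>?K \<partial>?K) + \<dots> \<le> ennreal (T\<^sup>2 * pi / 4) + ennreal (T\<^sup>2 * pi / 4)"
    by (intro add_mono nn_integral_bridge_bound T)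
  also have "ennreal T * (ennreal (T\<^sup>2 * pi / 4) + ennreal (T\<^sup>2 * pi / 4)) = ennreal (T ^ 3 * pi / 2)"
    using T by (simp add: ennreal_plus[symmetric] ennreal_mult[symmetric] power2_eq_square power3_eq_cube del: ennreal_plus)
  finally show ?thesis
    by (simp add: mult_left_mono)
qed

end

section \<open>Convergence\<close>

text \<open>The family increases as \<open>\<epsilon>\<close> decreases, so its limit I is its
  supremum, finite almost surely by the moment bound. Then 0 \<le> J \<le> I bounds the squared
  error by I^2.\<close>

lemma (in prob_space) antimono_L2_bounded_imp_L2_convergent:
  fixes J :: "real \<Rightarrow> 'a \<Rightarrow> real" and C :: real
  assumes meas [measurable]: "\<And>\<epsilon>. J \<epsilon> \<in> borel_measurable M"
    and nonneg: "\<And>\<epsilon> \<omega>. 0 < \<epsilon> \<Longrightarrow> \<omega> \<in> space M \<Longrightarrow> 0 \<le> J \<epsilon> \<omega>"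
    and anti: "\<And>\<epsilon> \<delta> \<omega>. 0 < \<delta> \<Longrightarrow> \<delta> \<le> \<epsilon> \<Longrightarrow> \<omega> \<in> space M \<Longrightarrow> J \<epsilon> \<omega> \<le> J \<delta> \<omega>"
    and bounded: "\<And>\<epsilon>. 0 < \<epsilon> \<Longrightarrow> (\<integral>\<^sup>+\<omega>. ennreal ((J \<epsilon> \<omega>)\<^sup>2) \<partial>M) \<le> ennreal C"
  shows "\<exists>I. I \<in> borel_measurable M \<and> integrable M (\<lambda>\<omega>. (I \<omega>)\<^sup>2) \<and>
    (\<forall>\<epsilon>>0. integrable M (\<lambda>\<omega>. (J \<epsilon> \<omega>)\<^sup>2)) \<and>
    ((\<lambda>\<epsilon>. \<integral>\<omega>. (J \<epsilon> \<omega> - I \<omega>)\<^sup>2 \<partial>M) \<longlongrightarrow> 0) (at_right 0)"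
proof -
  \<comment> \<open>The convergence theorems concern sequences; \<open>Suc n\<close> keeps the
    parameters positive.\<close>
  define j where "j = (\<lambda>n. J (1 / real (Suc n)))"
  \<comment> \<open>\<open>lim\<close> is total, so \<open>I\<close> is measurable everywhere; where
    the sequence diverges, a null set, its value is irrelevant.\<close>
  define I where "I = (\<lambda>\<omega>. lim (\<lambda>n. j n \<omega>))"
  have [measurable]: "j n \<in> borel_measurable M" for n by (simp add: j_def)
  have I_meas [measurable]: "I \<in> borel_measurable M"
    unfolding I_def by (rule borel_measurable_lim_metric) measurable
  have j_nonneg: "0 \<le> j n \<omega>" if "\<omega> \<in> space M" for n \<omega>
    using nonneg that by (simp add: j_def)
  have j_mono: "j m \<omega> \<le> j n \<omega>" if "\<omega> \<in> space M" "m \<le> n" for m n \<omega>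
    unfolding j_def using that by (intro anti) (auto simp: frac_le)
  have "(\<integral>\<^sup>+\<omega>. (SUP n. ennreal ((j n \<omega>)\<^sup>2)) \<partial>M) = (SUP n. \<integral>\<^sup>+\<omega>. ennreal ((j n \<omega>)\<^sup>2) \<partial>M)"
    by (intro nn_integral_monotone_convergence_SUP_AE AE_I2) (auto intro!: ennreal_leI power_mono j_mono j_nonneg)
  also have "\<dots> \<le> ennreal C"
    by (rule SUP_least) (auto simp: j_def intro!: bounded)
  finally have sup_le: "(\<integral>\<^sup>+\<omega>. (SUP n. ennreal ((j n \<omega>)\<^sup>2)) \<partial>M) \<le> ennreal C" .
  have "AE \<omega> in M. (SUP n. ennreal ((j n \<omega>)\<^sup>2)) \<noteq> \<infinity>"
    by (rule nn_integral_noteq_infinite) (use sup_le in \<open>auto simp: top_unique\<close>)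
  moreover have lim: "(\<lambda>n. j n \<omega>) \<longlonglongrightarrow> I \<omega>"
    if fin: "(SUP n. ennreal ((j n \<omega>)\<^sup>2)) \<noteq> \<infinity>" and \<omega>: "\<omega> \<in> space M" for \<omega>
  proof -
    obtain D where D: "(SUP n. ennreal ((j n \<omega>)\<^sup>2)) = ennreal D" "0 \<le> D"
      using fin by (cases "SUP n. ennreal ((j n \<omega>)\<^sup>2)") auto
    have "j n \<omega> \<le> sqrt D" for n
    proof -
      have "ennreal ((j n \<omega>)\<^sup>2) \<le> ennreal D"
        unfolding D(1)[symmetric] by (rule SUP_upper) simp
      then show ?thesis using D(2) by (simp add: real_le_rsqrt)
    qed
    then have "convergent (\<lambda>n. j n \<omega>)"
      using j_mono[OF \<omega>] by (intro Bseq_mono_convergent BseqI'[of _ "sqrt D"]) (auto simp: j_nonneg \<omega>)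
    then show ?thesis unfolding I_def by (simp add: convergent_LIMSEQ_iff)
  qed
  ultimately have j_lim: "AE \<omega> in M. (\<lambda>n. j n \<omega>) \<longlonglongrightarrow> I \<omega>"
    by (auto elim: eventually_mono)
  have J_le: "AE \<omega> in M. \<forall>\<epsilon>>0. J \<epsilon> \<omega> \<le> I \<omega>"
    using j_lim AE_space
  proof eventually_elim
    case (elim \<omega>)
    show ?case
    proof (intro allI impI)
      fix \<epsilon> :: real assume "0 < \<epsilon>"
      then obtain n where n: "1 / real (Suc n) < \<epsilon>" using nat_approx_posE by blast
      have "J \<epsilon> \<omega> \<le> j n \<omega>" unfolding j_def using n elim by (intro anti) auto
      also have "j n \<omega> \<le> I \<omega>"
        using elim j_mono by (intro LIMSEQ_le_const[OF elim(1)]) auto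
      finally show "J \<epsilon> \<omega> \<le> I \<omega>" .
    qed
  qed
  \<comment> \<open>I^2 is the limit of the squares, hence below their supremum, whose integral is
    at most C by monotone convergence.\<close>
  have int_I: "integrable M (\<lambda>\<omega>. (I \<omega>)\<^sup>2)"
  proof (rule integrableI_nonneg)
    have "(\<integral>\<^sup>+\<omega>. ennreal ((I \<omega>)\<^sup>2) \<partial>M) \<le> (\<integral>\<^sup>+\<omega>. (SUP n. ennreal ((j n \<omega>)\<^sup>2)) \<partial>M)"
    proof (rule nn_integral_mono_AE)
      show "AE \<omega> in M. ennreal ((I \<omega>)\<^sup>2) \<le> (SUP n. ennreal ((j n \<omega>)\<^sup>2))"
        using j_lim
      proof eventually_elim
        case (elim \<omega>)
        have "(\<lambda>n. ennreal ((j n \<omega>)\<^sup>2)) \<longlonglongrightarrow> ennreal ((I \<omega>)\<^sup>2)"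
          using elim by (intro tendsto_ennrealI tendsto_power)
        then show ?case by (rule LIMSEQ_le_const2) (intro exI allI impI SUP_upper UNIV_I)
      qed
    qed
    from le_less_trans[OF order_trans[OF this sup_le] ennreal_less_top]
    show "(\<integral>\<^sup>+\<omega>. ennreal ((I \<omega>)\<^sup>2) \<partial>M) < \<infinity>"
      by simp
  qed auto
  have int_J: "integrable M (\<lambda>\<omega>. (J \<epsilon> \<omega>)\<^sup>2)" if "0 < \<epsilon>" for \<epsilon>
  proof (rule integrableI_nonneg)
    show "(\<integral>\<^sup>+\<omega>. ennreal ((J \<epsilon> \<omega>)\<^sup>2) \<partial>M) < \<infinity>"
      using le_less_trans[OF bounded[OF that] ennreal_less_top] by simp
  qed auto
  have "((\<lambda>\<epsilon>. \<integral>\<omega>. (J \<epsilon> \<omega> - I \<omega>)\<^sup>2 \<partial>M) \<longlongrightarrow> 0) (at_right 0)"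
  proof -
    have diff_le: "AE \<omega> in M. (J \<epsilon> \<omega> - I \<omega>)\<^sup>2 \<le> (I \<omega>)\<^sup>2" if "0 < \<epsilon>" for \<epsilon>
      using J_le AE_space
    proof eventually_elim
      case (elim \<omega>)
      with that nonneg have "0 \<le> J \<epsilon> \<omega>" "J \<epsilon> \<omega> \<le> I \<omega>" by auto
      then show ?case by (intro power2_le_iff_abs_le[THEN iffD2]) auto
    qed
    have int_diff: "integrable M (\<lambda>\<omega>. (J \<epsilon> \<omega> - I \<omega>)\<^sup>2)" if "0 < \<epsilon>" for \<epsilon>
      by (rule Bochner_Integration.integrable_bound[OF int_I]) (use diff_le[OF that] in auto)
    have lim0: "(\<lambda>n. \<integral>\<omega>. (j n \<omega> - I \<omega>)\<^sup>2 \<partial>M) \<longlonglongrightarrow> (\<integral>\<omega>. 0 \<partial>M)"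
    proof (rule integral_dominated_convergence[OF _ _ int_I])
      show "AE \<omega> in M. (\<lambda>n. (j n \<omega> - I \<omega>)\<^sup>2) \<longlonglongrightarrow> 0"
        using j_lim by eventually_elim (auto intro!: tendsto_eq_intros)
      show "AE \<omega> in M. norm ((j n \<omega> - I \<omega>)\<^sup>2) \<le> (I \<omega>)\<^sup>2" for n
        using diff_le[of "1 / real (Suc n)"] by (simp add: j_def)
    qed measurable
    \<comment> \<open>This passes from the sequence to the continuous parameter: for
      \<open>\<epsilon> < 1 / real (Suc n)\<close>, J lies between \<open>j n\<close> and I almost
      surely, so its error is no larger.\<close>
    have mono: "(\<integral>\<omega>. (J \<epsilon> \<omega> - I \<omega>)\<^sup>2 \<partial>M) \<le> (\<integral>\<omega>. (j n \<omega> - I \<omega>)\<^sup>2 \<partial>M)"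
      if "0 < \<epsilon>" "\<epsilon> < 1 / real (Suc n)" for \<epsilon> n
    proof (rule integral_mono_AE)
      show "AE \<omega> in M. (J \<epsilon> \<omega> - I \<omega>)\<^sup>2 \<le> (j n \<omega> - I \<omega>)\<^sup>2"
        using J_le AE_space
      proof eventually_elim
        case (elim \<omega>)
        have "j n \<omega> \<le> J \<epsilon> \<omega>" "J \<epsilon> \<omega> \<le> I \<omega>"
          using that elim anti[of \<epsilon> "1 / real (Suc n)"] by (auto simp: j_def)
        then have "\<bar>J \<epsilon> \<omega> - I \<omega>\<bar> \<le> \<bar>j n \<omega> - I \<omega>\<bar>" by auto
        then show ?case by (simp add: abs_le_square_iff)
      qed
    qed (use that in \<open>auto simp: j_def intro: int_diff\<close>)
    show ?thesis
    proof (rule tendstoI)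
      fix e :: real assume "0 < e"
      then have "eventually (\<lambda>n. (\<integral>\<omega>. (j n \<omega> - I \<omega>)\<^sup>2 \<partial>M) < e) sequentially"
        using order_tendstoD(2)[OF lim0, of e] by simp
      then obtain n where n: "(\<integral>\<omega>. (j n \<omega> - I \<omega>)\<^sup>2 \<partial>M) < e"
        by (rule eventually_happens'[OF sequentially_bot, THEN exE])
      have "eventually (\<lambda>\<epsilon>. \<epsilon> \<in> {0<..<1 / real (Suc n)}) (at_right 0)"
        by (rule eventually_at_right_real) simp
      then show "eventually (\<lambda>\<epsilon>. dist (\<integral>\<omega>. (J \<epsilon> \<omega> - I \<omega>)\<^sup>2 \<partial>M) 0 < e) (at_right 0)"
        by eventually_elim (use mono n in \<open>force simp: integral_nonneg_AE\<close>)
    qed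
  qed
  with I_meas int_I int_J show ?thesis by blast
qed

text \<open>An arbitrary standard Brownian motion stands for the white noise construction. The
  approximations are real, so the squared L2 distance is the integral of a real square.\<close>

theorem theorem3p1:
  fixes M :: "'a measure" and B :: "real \<Rightarrow> 'a \<Rightarrow> real" and T a b :: real
  assumes "std_brownian_motion M B" and "0 < T"
  shows "\<exists>I. I \<in> borel_measurable M \<and> integrable M (\<lambda>\<omega>. (I \<omega>)\<^sup>2) \<and>
    (\<forall>\<epsilon>>0. approx_SILT T a b B \<epsilon> \<in> borel_measurable M \<and>
             integrable M (\<lambda>\<omega>. (approx_SILT T a b B \<epsilon> \<omega>)\<^sup>2)) \<and>
    ((\<lambda>\<epsilon>. \<integral>\<omega>. (approx_SILT T a b B \<epsilon> \<omega> - I \<omega>)\<^sup>2 \<partial>M) \<longlongrightarrow> 0) (at_right 0)"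
proof -
  interpret prob_space M
    using assms(1) by (simp add: std_brownian_motion_def)
  interpret brownian_bridge_setting M B T a b
    by unfold_locales (use assms in auto)
  have "\<exists>I. I \<in> borel_measurable M \<and> integrable M (\<lambda>\<omega>. (I \<omega>)\<^sup>2) \<and>
    (\<forall>\<epsilon>>0. integrable M (\<lambda>\<omega>. (approx_SILT T a b B \<epsilon> \<omega>)\<^sup>2)) \<and>
    ((\<lambda>\<epsilon>. \<integral>\<omega>. (approx_SILT T a b B \<epsilon> \<omega> - I \<omega>)\<^sup>2 \<partial>M) \<longlongrightarrow> 0) (at_right 0)"
  proof (rule antimono_L2_bounded_imp_L2_convergent[OF measurable_approx_SILT _ _ second_moment_approx_SILT_le])
    show "0 \<le> approx_SILT T a b B \<epsilon> \<omega>" if "0 < \<epsilon>" "\<omega> \<in> space M" for \<epsilon> \<omega>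
      unfolding approx_SILT_eq_self_energy using that by (intro self_energy_nonneg measurable_X_path)
    show "approx_SILT T a b B \<epsilon> \<omega> \<le> approx_SILT T a b B \<delta> \<omega>"
      if "0 < \<delta>" "\<delta> \<le> \<epsilon>" "\<omega> \<in> space M" for \<epsilon> \<delta> \<omega>
      unfolding approx_SILT_eq_self_energy using that by (intro self_energy_antimono measurable_X_path)
  qed
  then show ?thesis using measurable_approx_SILT by blast
qed

end
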